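(* Let $\mathcal{R}$ be a commutative ring with unit, $\mathcal{A}$ an associative commutative $\mathcal{R}$-algebra with unit, and $\mathcal{F}$ a faithful $\mathcal{A}$-module. Let $B:\mathcal{F}\times\mathcal{F}\to\mathcal{F}$ be an $\mathcal{R}$-bilinear form, and let $\mathcal{F}_B=\{(ad^L_X,X): X\in\mathcal{F}\}\subseteq \mathfrak{gl}(\mathcal{F})\times\mathcal{F}$ be its graph, where $ad^L_X(Y)=B(X,Y)$. Then $\mathcal{F}_B$ is closed under the bracket $\{(\Phi,X),(\Psi,Y)\}=([\Phi,\Psi],\Phi Y)$ on $\mathfrak{gl}(\mathcal{F})\times\mathcal{F}$ if and only if $(\mathcal{F},B)$ is a left Loday algebra. Moreover, if $B$ is antisymmetric, then $\mathcal{F}_B$ is closed under $\{\;,\;\}$ if and only if $(\mathcal{F},B)$ is a Lie algebra.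
   Context: $\mathcal{F}$ is regarded as an $\mathcal{R}$-module via $\mathcal{R}\to\mathcal{A}$. $\mathfrak{gl}(\mathcal{F})=End_{\mathcal{R}}(\mathcal{F})$ is the space of $\mathcal{R}$-linear endomorphisms of $\mathcal{F}$, and $[\Phi,\Psi]=\Phi\circ\Psi-\Psi\circ\Phi$. Closed under $\{\;,\;\}$ means that the bracket of any two elements of $\mathcal{F}_B$ lies in $\mathcal{F}_B$. $(\mathcal{F},B)$ with $B$ $\mathcal{R}$-bilinear is a left Loday algebra if $B(X,B(Y,Z))=B(B(X,Y),Z)+B(Y,B(X,Z))$ for all $X,Y,Z\in\mathcal{F}$. Antisymmetric means $B(X,Y)=-B(Y,X)$ for all $X,Y$. $(\mathcal{F},B)$ is a Lie algebra if $B$ is $\mathcal{R}$-bilinear, antisymmetric and satisfies the Jacobi identity $B(X,B(Y,Z))+B(Z,B(X,Y))+B(Y,B(Z,X))=0$. *)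

theory Defs
  imports "HOL-Algebra.Module"
begin

locale faithful_module = module +
  assumes faithful:
    "\<lbrakk>a \<in> carrier R; \<And>x. x \<in> carrier M \<Longrightarrow> a \<odot>\<^bsub>M\<^esub> x = \<zero>\<^bsub>M\<^esub>\<rbrakk> \<Longrightarrow> a = \<zero>"

(* An A-module F as a module over the base ring of the algebra A, along the structure map
   sending r to r \<odot> \<one> in A.  The ring fields mult and one of a module record carry no meaning. *)
definition restrict_scalars ::
  "('r, 'a, 'm) module_scheme \<Rightarrow> ('a, 'f, 'n) module_scheme \<Rightarrow> ('r, 'f) module" where
  "restrict_scalars A F =
    \<lparr>carrier = carrier F, mult = mult F, one = one F, zero = zero F, add = add F,
     smult = (\<lambda>r x. (r \<odot>\<^bsub>A\<^esub> \<one>\<^bsub>A\<^esub>) \<odot>\<^bsub>F\<^esub> x)\<rparr>"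

lemma module_restrict_scalars:
  assumes "algebra R A" and "module A F"
  shows "module R (restrict_scalars A F)"
proof -
  interpret A: algebra R A by fact
  interpret F: module A F by fact
  have grp: "abelian_group (restrict_scalars A F)"
    by (rule abelian_groupI)
      (auto simp: restrict_scalars_def F.M.a_ac intro: F.l_neg F.a_inv_closed)
  show ?thesis
  proof (rule moduleI[OF A.R_cring grp])
    fix a b x assume *: "a \<in> carrier R" "b \<in> carrier R" "x \<in> carrier (restrict_scalars A F)"
    have "(a \<odot>\<^bsub>A\<^esub> \<one>\<^bsub>A\<^esub>) \<otimes>\<^bsub>A\<^esub> (b \<odot>\<^bsub>A\<^esub> \<one>\<^bsub>A\<^esub>) = (a \<otimes>\<^bsub>R\<^esub> b) \<odot>\<^bsub>A\<^esub> \<one>\<^bsub>A\<^esub>"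
      using * by (simp add: A.smult_assoc2 A.smult_assoc1)
    then show "(a \<otimes>\<^bsub>R\<^esub> b) \<odot>\<^bsub>restrict_scalars A F\<^esub> x =
        a \<odot>\<^bsub>restrict_scalars A F\<^esub> (b \<odot>\<^bsub>restrict_scalars A F\<^esub> x)"
      using * by (simp add: restrict_scalars_def F.smult_assoc1[symmetric])
  qed (auto simp: restrict_scalars_def A.smult_l_distr F.smult_l_distr F.smult_r_distr)
qed

definition linear_endomorphism ::
  "('r, 'k) ring_scheme \<Rightarrow> ('r, 'f, 'n) module_scheme \<Rightarrow> ('f \<Rightarrow> 'f) \<Rightarrow> bool" where
  "linear_endomorphism R M \<Phi> \<longleftrightarrow>
    \<Phi> \<in> carrier M \<rightarrow> carrier M \<and>
    (\<forall>x\<in>carrier M. \<forall>y\<in>carrier M. \<Phi> (x \<oplus>\<^bsub>M\<^esub> y) = \<Phi> x \<oplus>\<^bsub>M\<^esub> \<Phi> y) \<and>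
    (\<forall>r\<in>carrier R. \<forall>x\<in>carrier M. \<Phi> (r \<odot>\<^bsub>M\<^esub> x) = r \<odot>\<^bsub>M\<^esub> \<Phi> x)"

(* Endomorphisms are extensional, so that HOL equality is equality of maps on the carrier. *)
definition gl :: "('r, 'k) ring_scheme \<Rightarrow> ('r, 'f, 'n) module_scheme \<Rightarrow> ('f \<Rightarrow> 'f) set" where
  "gl R M = {\<Phi> \<in> extensional (carrier M). linear_endomorphism R M \<Phi>}"

definition commutator ::
  "('r, 'f, 'n) module_scheme \<Rightarrow> ('f \<Rightarrow> 'f) \<Rightarrow> ('f \<Rightarrow> 'f) \<Rightarrow> ('f \<Rightarrow> 'f)" where
  "commutator M \<Phi> \<Psi> =
    (\<lambda>x\<in>carrier M. compose (carrier M) \<Phi> \<Psi> x \<ominus>\<^bsub>M\<^esub> compose (carrier M) \<Psi> \<Phi> x)"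

definition gl_bracket ::
  "('r, 'f, 'n) module_scheme \<Rightarrow> ('f \<Rightarrow> 'f) \<times> 'f \<Rightarrow> ('f \<Rightarrow> 'f) \<times> 'f \<Rightarrow> ('f \<Rightarrow> 'f) \<times> 'f" where
  "gl_bracket M = (\<lambda>(\<Phi>, X) (\<Psi>, Y). (commutator M \<Phi> \<Psi>, \<Phi> Y))"

definition closed_under_bracket ::
  "('r, 'f, 'n) module_scheme \<Rightarrow> (('f \<Rightarrow> 'f) \<times> 'f) set \<Rightarrow> bool" where
  "closed_under_bracket M S \<longleftrightarrow> (\<forall>p\<in>S. \<forall>q\<in>S. gl_bracket M p q \<in> S)"

definition bilinear_form ::
  "('r, 'k) ring_scheme \<Rightarrow> ('r, 'f, 'n) module_scheme \<Rightarrow> ('f \<Rightarrow> 'f \<Rightarrow> 'f) \<Rightarrow> bool" where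
  "bilinear_form R M B \<longleftrightarrow>
    (\<forall>x\<in>carrier M. linear_endomorphism R M (\<lambda>y. B x y)) \<and>
    (\<forall>y\<in>carrier M. linear_endomorphism R M (\<lambda>x. B x y))"

definition ad_L ::
  "('r, 'f, 'n) module_scheme \<Rightarrow> ('f \<Rightarrow> 'f \<Rightarrow> 'f) \<Rightarrow> 'f \<Rightarrow> ('f \<Rightarrow> 'f)" where
  "ad_L M B X = (\<lambda>Y\<in>carrier M. B X Y)"

definition ad_graph ::
  "('r, 'f, 'n) module_scheme \<Rightarrow> ('f \<Rightarrow> 'f \<Rightarrow> 'f) \<Rightarrow> (('f \<Rightarrow> 'f) \<times> 'f) set" where
  "ad_graph M B = {(ad_L M B X, X) | X. X \<in> carrier M}"

definition left_loday_algebra ::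
  "('r, 'k) ring_scheme \<Rightarrow> ('r, 'f, 'n) module_scheme \<Rightarrow> ('f \<Rightarrow> 'f \<Rightarrow> 'f) \<Rightarrow> bool" where
  "left_loday_algebra R M B \<longleftrightarrow>
    bilinear_form R M B \<and>
    (\<forall>X\<in>carrier M. \<forall>Y\<in>carrier M. \<forall>Z\<in>carrier M.
      B X (B Y Z) = B (B X Y) Z \<oplus>\<^bsub>M\<^esub> B Y (B X Z))"

definition antisymmetric_form ::
  "('r, 'f, 'n) module_scheme \<Rightarrow> ('f \<Rightarrow> 'f \<Rightarrow> 'f) \<Rightarrow> bool" where
  "antisymmetric_form M B \<longleftrightarrow>
    (\<forall>X\<in>carrier M. \<forall>Y\<in>carrier M. B X Y = \<ominus>\<^bsub>M\<^esub> B Y X)"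

definition lie_algebra ::
  "('r, 'k) ring_scheme \<Rightarrow> ('r, 'f, 'n) module_scheme \<Rightarrow> ('f \<Rightarrow> 'f \<Rightarrow> 'f) \<Rightarrow> bool" where
  "lie_algebra R M B \<longleftrightarrow>
    bilinear_form R M B \<and> antisymmetric_form M B \<and>
    (\<forall>X\<in>carrier M. \<forall>Y\<in>carrier M. \<forall>Z\<in>carrier M.
      B X (B Y Z) \<oplus>\<^bsub>M\<^esub> B Z (B X Y) \<oplus>\<^bsub>M\<^esub> B Y (B Z X) = \<zero>\<^bsub>M\<^esub>)"

lemma ad_graph_subset:
  assumes "module R M" and "bilinear_form R M B"
  shows "ad_graph M B \<subseteq> gl R M \<times> carrier M"
proof -
  interpret module R M by fact
  show ?thesis
    using assms(2)
    by (auto simp: ad_graph_def gl_def ad_L_def bilinear_form_def linear_endomorphism_def)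
qed

lemma gl_bracket_closed:
  assumes "module R M" and "p \<in> gl R M \<times> carrier M" and "q \<in> gl R M \<times> carrier M"
  shows "gl_bracket M p q \<in> gl R M \<times> carrier M"
proof -
  interpret module R M by fact
  obtain \<Phi> X \<Psi> Y where pq: "p = (\<Phi>, X)" "q = (\<Psi>, Y)" by (metis surj_pair)
  have *: "linear_endomorphism R M \<Phi>" "linear_endomorphism R M \<Psi>" "Y \<in> carrier M"
    using assms(2,3) by (auto simp: pq gl_def)
  then have c: "\<And>x. x \<in> carrier M \<Longrightarrow> \<Phi> x \<in> carrier M" "\<And>x. x \<in> carrier M \<Longrightarrow> \<Psi> x \<in> carrier M"
    by (auto simp: linear_endomorphism_def)
  have "linear_endomorphism R M (commutator M \<Phi> \<Psi>)"
    using * c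
    by (auto simp: linear_endomorphism_def commutator_def compose_eq a_minus_def
        smult_r_distr smult_r_minus M.minus_add M.a_ac)
  then show ?thesis
    using * c by (simp add: pq gl_bracket_def gl_def commutator_def)
qed

end

theory Submission
  imports Defs "HOL-Algebra.AbelCoset"
begin

text \<open>The second component of the bracket of \<open>(ad\<^sup>L\<^sub>X, X)\<close> and \<open>(ad\<^sup>L\<^sub>Y, Y)\<close> is \<open>B X Y\<close>, so the
  bracket can lie in the graph only as the point above \<open>B X Y\<close>: closedness says that \<open>ad\<^sup>L\<close> turns
  \<open>B\<close> into the commutator, which evaluated at \<open>Z\<close> is the left Leibniz identity. If \<open>B\<close> is
  antisymmetric, then \<open>B Z (B X Y) = - B (B X Y) Z\<close> and \<open>B Y (B Z X) = - B Y (B X Z)\<close>, which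
  turns the Jacobi identity into the Leibniz identity.\<close>

definition left_leibniz_identity :: "('f, 'n) ring_scheme \<Rightarrow> ('f \<Rightarrow> 'f \<Rightarrow> 'f) \<Rightarrow> bool" where
  "left_leibniz_identity M B \<longleftrightarrow>
    (\<forall>X\<in>carrier M. \<forall>Y\<in>carrier M. \<forall>Z\<in>carrier M.
      B X (B Y Z) = B (B X Y) Z \<oplus>\<^bsub>M\<^esub> B Y (B X Z))"

definition jacobi_identity :: "('f, 'n) ring_scheme \<Rightarrow> ('f \<Rightarrow> 'f \<Rightarrow> 'f) \<Rightarrow> bool" where
  "jacobi_identity M B \<longleftrightarrow>
    (\<forall>X\<in>carrier M. \<forall>Y\<in>carrier M. \<forall>Z\<in>carrier M.
      B X (B Y Z) \<oplus>\<^bsub>M\<^esub> B Z (B X Y) \<oplus>\<^bsub>M\<^esub> B Y (B Z X) = \<zero>\<^bsub>M\<^esub>)"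

lemma left_loday_algebra_iff_left_leibniz:
  "left_loday_algebra R M B \<longleftrightarrow> bilinear_form R M B \<and> left_leibniz_identity M B"
  by (simp add: left_loday_algebra_def left_leibniz_identity_def)

lemma lie_algebra_iff_jacobi:
  "lie_algebra R M B \<longleftrightarrow> bilinear_form R M B \<and> antisymmetric_form M B \<and> jacobi_identity M B"
  by (simp add: lie_algebra_def jacobi_identity_def)

lemma closed_ad_graph_iff_commutator:
  "closed_under_bracket M (ad_graph M B) \<longleftrightarrow>
    (\<forall>X\<in>carrier M. \<forall>Y\<in>carrier M.
      B X Y \<in> carrier M \<and> commutator M (ad_L M B X) (ad_L M B Y) = ad_L M B (B X Y))"
  by (auto simp: closed_under_bracket_def ad_graph_def gl_bracket_def ad_L_def)

lemma ad_L_apply: "Y \<in> carrier M \<Longrightarrow> ad_L M B X Y = B X Y"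
  by (simp add: ad_L_def)

lemma commutator_ad_L_apply:
  assumes "B \<in> carrier M \<rightarrow> carrier M \<rightarrow> carrier M"
    and "X \<in> carrier M" and "Y \<in> carrier M" and "Z \<in> carrier M"
  shows "commutator M (ad_L M B X) (ad_L M B Y) Z = B X (B Y Z) \<ominus>\<^bsub>M\<^esub> B Y (B X Z)"
proof -
  have "B X Z \<in> carrier M" and "B Y Z \<in> carrier M"
    using assms by blast+
  then show ?thesis
    using assms(4) by (simp add: commutator_def compose_eq ad_L_apply)
qed

lemma commutator_ad_L_eq_iff:
  fixes M (structure)
  assumes "abelian_group M" and closed: "B \<in> carrier M \<rightarrow> carrier M \<rightarrow> carrier M"
    and XY: "X \<in> carrier M" "Y \<in> carrier M"
  shows "commutator M (ad_L M B X) (ad_L M B Y) = ad_L M B (B X Y) \<longleftrightarrow>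
    (\<forall>Z\<in>carrier M. B X (B Y Z) = B (B X Y) Z \<oplus> B Y (B X Z))"
proof -
  interpret abelian_group M by fact
  have "commutator M (ad_L M B X) (ad_L M B Y) = ad_L M B (B X Y) \<longleftrightarrow>
      (\<forall>Z\<in>carrier M. commutator M (ad_L M B X) (ad_L M B Y) Z = ad_L M B (B X Y) Z)"
    by (intro iffI extensionalityI[where A = "carrier M"]) (simp_all add: commutator_def ad_L_def)
  also have "\<dots> \<longleftrightarrow> (\<forall>Z\<in>carrier M. B X (B Y Z) \<ominus> B Y (B X Z) = B (B X Y) Z)"
    using XY by (simp add: commutator_ad_L_apply[OF closed] ad_L_apply)
  also have "\<dots> \<longleftrightarrow> (\<forall>Z\<in>carrier M. B X (B Y Z) = B (B X Y) Z \<oplus> B Y (B X Z))"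
  proof (rule ball_cong[OF refl])
    fix Z assume "Z \<in> carrier M"
    then have "B (B X Y) Z \<in> carrier M" "B X (B Y Z) \<in> carrier M" "B Y (B X Z) \<in> carrier M"
      using closed XY by blast+
    then show "B X (B Y Z) \<ominus> B Y (B X Z) = B (B X Y) Z \<longleftrightarrow>
        B X (B Y Z) = B (B X Y) Z \<oplus> B Y (B X Z)"
      unfolding minus_eq by (rule add.inv_solve_right'[folded a_inv_def])
  qed
  finally show ?thesis .
qed

lemma closed_ad_graph_iff_left_leibniz:
  assumes "abelian_group M" and closed: "B \<in> carrier M \<rightarrow> carrier M \<rightarrow> carrier M"
  shows "closed_under_bracket M (ad_graph M B) \<longleftrightarrow> left_leibniz_identity M B"
proof -
  have "B X Y \<in> carrier M" if "X \<in> carrier M" "Y \<in> carrier M" for X Y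
    using closed that by blast
  then show ?thesis
    by (simp add: closed_ad_graph_iff_commutator commutator_ad_L_eq_iff[OF assms]
        left_leibniz_identity_def)
qed

lemma jacobiator_eq_leibniz_defect:
  fixes M (structure)
  assumes "abelian_group M"
    and closed: "B \<in> carrier M \<rightarrow> carrier M \<rightarrow> carrier M"
    and additive: "abelian_group_hom M M (B Y)"
    and antisymmetric: "antisymmetric_form M B"
    and XYZ: "X \<in> carrier M" "Y \<in> carrier M" "Z \<in> carrier M"
  shows "B X (B Y Z) \<oplus> B Z (B X Y) \<oplus> B Y (B Z X) =
    B X (B Y Z) \<ominus> (B (B X Y) Z \<oplus> B Y (B X Z))"
proof -
  interpret abelian_group M by fact
  have inner_closed: "B X Y \<in> carrier M" "B X Z \<in> carrier M"
    using closed XYZ by blast+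
  have terms_closed:
    "B X (B Y Z) \<in> carrier M" "B (B X Y) Z \<in> carrier M" "B Y (B X Z) \<in> carrier M"
    using closed XYZ by blast+
  have "B Z (B X Y) = \<ominus> B (B X Y) Z" and "B Z X = \<ominus> B X Z"
    using antisymmetric XYZ inner_closed unfolding antisymmetric_form_def by blast+
  moreover have "B Y (\<ominus> B X Z) = \<ominus> B Y (B X Z)"
    using additive inner_closed(2) by (rule abelian_group_hom.hom_a_inv)
  ultimately show ?thesis
    using terms_closed by (simp add: minus_eq minus_add a_assoc)
qed

lemma left_leibniz_iff_jacobi:
  fixes M (structure)
  assumes "abelian_group M"
    and additive: "\<And>X. X \<in> carrier M \<Longrightarrow> abelian_group_hom M M (B X)"
    and antisymmetric: "antisymmetric_form M B"
  shows "left_leibniz_identity M B \<longleftrightarrow> jacobi_identity M B"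
proof -
  interpret abelian_group M by fact
  have closed: "B \<in> carrier M \<rightarrow> carrier M \<rightarrow> carrier M"
    using additive by (auto intro: abelian_group_hom.hom_closed)
  have "B X (B Y Z) = B (B X Y) Z \<oplus> B Y (B X Z) \<longleftrightarrow>
      B X (B Y Z) \<oplus> B Z (B X Y) \<oplus> B Y (B Z X) = \<zero>"
    if XYZ: "X \<in> carrier M" "Y \<in> carrier M" "Z \<in> carrier M" for X Y Z
  proof -
    have "B X (B Y Z) \<in> carrier M" "B (B X Y) Z \<in> carrier M" "B Y (B X Z) \<in> carrier M"
      using closed XYZ by blast+
    then show ?thesis
      using XYZ additive
      by (simp add: jacobiator_eq_leibniz_defect[OF \<open>abelian_group M\<close> closed _ antisymmetric]
          minus_eq add.inv_solve_right'[folded a_inv_def])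
  qed
  then show ?thesis
    by (simp add: left_leibniz_identity_def jacobi_identity_def)
qed

lemma (in module) linear_endomorphism_imp_abelian_group_hom:
  assumes "linear_endomorphism R M \<Phi>"
  shows "abelian_group_hom M M \<Phi>"
proof (intro abelian_group_homI group_hom.intro group_hom_axioms.intro)
  show "\<Phi> \<in> hom (add_monoid M) (add_monoid M)"
    using assms by (auto simp: linear_endomorphism_def hom_def)
qed (rule M.abelian_group_axioms M.a_group)+

lemma bilinear_form_closed:
  "bilinear_form R M B \<Longrightarrow> B \<in> carrier M \<rightarrow> carrier M \<rightarrow> carrier M"
  by (auto simp: bilinear_form_def linear_endomorphism_def)

lemma (in module) closed_ad_graph_iff_left_loday:
  assumes "bilinear_form R M B"
  shows "closed_under_bracket M (ad_graph M B) \<longleftrightarrow> left_loday_algebra R M B"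
  using assms closed_ad_graph_iff_left_leibniz[OF M.abelian_group_axioms bilinear_form_closed]
  by (simp add: left_loday_algebra_iff_left_leibniz)

lemma (in module) left_loday_iff_lie:
  assumes bilinear: "bilinear_form R M B" and antisymmetric: "antisymmetric_form M B"
  shows "left_loday_algebra R M B \<longleftrightarrow> lie_algebra R M B"
proof -
  have "abelian_group_hom M M (B X)" if "X \<in> carrier M" for X
    using bilinear that
    by (simp add: bilinear_form_def linear_endomorphism_imp_abelian_group_hom)
  then have "left_leibniz_identity M B \<longleftrightarrow> jacobi_identity M B"
    using antisymmetric by (intro left_leibniz_iff_jacobi M.abelian_group_axioms)
  then show ?thesis
    using assms by (simp add: left_loday_algebra_iff_left_leibniz lie_algebra_iff_jacobi)
qed

theorem proposition2:
  fixes R :: "('r, 'k) ring_scheme"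
    and A :: "('r, 'a, 'm) module_scheme"
    and F :: "('a, 'f, 'n) module_scheme"
    and B :: "'f \<Rightarrow> 'f \<Rightarrow> 'f"
  assumes "cring R"
    and "algebra R A"
    and "faithful_module A F"
    and "bilinear_form R (restrict_scalars A F) B"
  shows "(closed_under_bracket (restrict_scalars A F) (ad_graph (restrict_scalars A F) B)
            \<longleftrightarrow> left_loday_algebra R (restrict_scalars A F) B)
       \<and> (antisymmetric_form (restrict_scalars A F) B \<longrightarrow>
           (closed_under_bracket (restrict_scalars A F) (ad_graph (restrict_scalars A F) B)
            \<longleftrightarrow> lie_algebra R (restrict_scalars A F) B))"
proof -
  interpret module R "restrict_scalars A F"
    using assms(2,3) by (intro module_restrict_scalars) (simp_all add: faithful_module_def)
  show ?thesis
    using closed_ad_graph_iff_left_loday[OF assms(4)] left_loday_iff_lie[OF assms(4)] by simp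
qed

end
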